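(* Let $(A,\circ_A)$ be a $\mathcal{P}$-algebra and let $M\in M_2(\mathbb{K})$. Then there is a compatible type-$M$ pre-$\mathcal{P}$-algebra structure $(A,\succ_A,\prec_A)$ on $(A,\circ_A)$ if and only if there is an invertible type-$M$ $\mathcal{O}$-operator $T:V\to A$ of $(A,\circ_A)$ associated to $(\alpha,\beta,V)$ for some vector space $V$ and some linear maps $\alpha,\beta:A\to \mathrm{End}_{\mathbb{K}}(V)$. In this case, given such a $T$, the multiplications $\succ_A$ and $\prec_A$ are defined by $$x\succ_A y=T\big(\alpha(x)T^{-1}(y)\big),\qquad x\prec_A y=T\big(\beta(y)T^{-1}(x)\big),\qquad \forall x,y\in A.$$
   Context: Throughout, $\mathbb{K}$ is an algebraically closed field of characteristic zero and all vector spaces are finite-dimensional over $\mathbb{K}$. $\mathcal{P}$ is a binary quadratic operad with one binary operation; a $\mathcal{P}$-algebra is a vector space $A$ with a bilinear multiplication $\circ_A$ satisfying a fixed set of identities (depending only on $\mathcal{P}$), each stating that a fixed $\mathbb{K}$-linear combination of the twelve monomials $(x_{\sigma(1)}\circ_A x_{\sigma(2)})\circ_A x_{\sigma(3)}$ and $x_{\sigma(1)}\circ_A(x_{\sigma(2)}\circ_A x_{\sigma(3)})$, $\sigma\in S_3$, vanishes for all $x_1,x_2,x_3\in A$ (if the generating operation of $\mathcal{P}$ is symmetric or antisymmetric, the corresponding identity $x\circ_A y=\pm y\circ_A x$ is also imposed). Representation: for a $\mathcal{P}$-algebra $(A,\circ_A)$, a vector space $V$ and linear maps $l,r:A\to\mathrm{End}_{\mathbb{K}}(V)$,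 the triple $(l,r,V)$ is a representation of $(A,\circ_A)$ if $A\oplus V$ is a $\mathcal{P}$-algebra with multiplication $(x+u)\circ_d(y+v)=x\circ_A y+l(x)v+r(y)u$ for $x,y\in A$, $u,v\in V$. For $M=\begin{pmatrix} a_1 & b_1 \\ a_2 & b_2 \end{pmatrix}$ and linear maps $f,g$, write $(f,g)M:=(a_1f+a_2g,\;b_1f+b_2g)$. For multiplications $\succ_A,\prec_A$ on $A$, set $L_{\succ_A}(x)y=x\succ_A y$ and $R_{\prec_A}(x)y=y\prec_A x$. Type-$M$ pre-$\mathcal{P}$-algebra: a vector space $A$ with bilinear multiplications $\succ_A,\prec_A$ such that $(A,\circ_A)$ with $x\circ_A y:=x\succ_A y+x\prec_A y$ is a $\mathcal{P}$-algebra and $\big((L_{\succ_A},R_{\prec_A})M,A\big)=(a_1L_{\succ_A}+a_2R_{\prec_A},\,b_1L_{\succ_A}+b_2R_{\prec_A},\,A)$ is a representation of $(A,\circ_A)$. It is then called compatible on $(A,\circ_A)$. Type-$M$ $\mathcal{O}$-operator: let $\alpha,\beta:A\to\mathrm{End}_{\mathbb{K}}(V)$ be linear maps such that $\big((\alpha,\beta)M,V\big)$ is a representation of $(A,\circ_A)$. A linear map $T:V\to A$ with $(Tu)\circ_A(Tv)=T\big(\alpha(Tu)v+\beta(Tv)u\big)$ for all $u,v\in V$ is called a type-$M$ $\mathcal{O}$-operator of $(A,\circ_A)$ associated to $(\alpha,\beta,V)$. *)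

theory Defs
  imports "HOL-Analysis.Analysis" "HOL-Library.Function_Algebras"
begin

text \<open>
  A vector space is given by a scalar multiplication \<open>s\<close> on an ambient type together with a
  carrier \<open>V\<close>, a linear subspace of the ambient space; functions on \<open>V\<close> are total functions on
  the ambient type of which only the values on \<open>V\<close> matter.  A space whose carrier is a whole type
  has carrier \<open>UNIV\<close>.
\<close>

definition fd_space :: "('k::field \<Rightarrow> 'v::ab_group_add \<Rightarrow> 'v) \<Rightarrow> 'v set \<Rightarrow> bool" where
  "fd_space s V \<longleftrightarrow> vector_space s \<and> module.subspace s V \<and> (\<exists>B. finite B \<and> module.span s B = V)"

definition linear_on ::
  "('k::field \<Rightarrow> 'v::ab_group_add \<Rightarrow> 'v) \<Rightarrow> 'v set \<Rightarrow> ('k \<Rightarrow> 'w::ab_group_add \<Rightarrow> 'w) \<Rightarrow> 'w set \<Rightarrow>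
    ('v \<Rightarrow> 'w) \<Rightarrow> bool" where
  "linear_on s V t W f \<longleftrightarrow>
     (\<forall>x\<in>V. f x \<in> W) \<and> (\<forall>x\<in>V. \<forall>y\<in>V. f (x + y) = f x + f y) \<and> (\<forall>c. \<forall>x\<in>V. f (s c x) = t c (f x))"

definition bilinear_on ::
  "('k::field \<Rightarrow> 'u::ab_group_add \<Rightarrow> 'u) \<Rightarrow> 'u set \<Rightarrow> ('k \<Rightarrow> 'v::ab_group_add \<Rightarrow> 'v) \<Rightarrow> 'v set \<Rightarrow>
    ('k \<Rightarrow> 'w::ab_group_add \<Rightarrow> 'w) \<Rightarrow> 'w set \<Rightarrow> ('u \<Rightarrow> 'v \<Rightarrow> 'w) \<Rightarrow> bool" where
  "bilinear_on r U s V t W f \<longleftrightarrow>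
     (\<forall>x\<in>U. linear_on s V t W (f x)) \<and> (\<forall>y\<in>V. linear_on r U t W (\<lambda>x. f x y))"

text \<open>A linear map \<open>A \<rightarrow> End(V)\<close> is, in curried form, a bilinear map \<open>A \<times> V \<rightarrow> V\<close>.\<close>

abbreviation linear_to_End ::
  "('k::field \<Rightarrow> 'a::ab_group_add \<Rightarrow> 'a) \<Rightarrow> ('k \<Rightarrow> 'v::ab_group_add \<Rightarrow> 'v) \<Rightarrow> 'v set \<Rightarrow>
    ('a \<Rightarrow> 'v \<Rightarrow> 'v) \<Rightarrow> bool" where
  "linear_to_End sA sV V l \<equiv> bilinear_on sA UNIV sV V sV V l"

text \<open>
  A binary quadratic operad with one binary operation is presented by the symmetry type of the
  operation and a set of quadratic relations.  A relation is a pair \<open>(c, d)\<close> of families of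
  coefficients indexed by the permutations \<open>\<sigma>\<close> of \<open>{1,2,3}\<close>: \<open>c \<sigma>\<close> is the coefficient of
  \<open>(x\<^bsub>\<sigma>(1)\<^esub> x\<^bsub>\<sigma>(2)\<^esub>) x\<^bsub>\<sigma>(3)\<^esub>\<close> and \<open>d \<sigma>\<close> that of \<open>x\<^bsub>\<sigma>(1)\<^esub> (x\<^bsub>\<sigma>(2)\<^esub> x\<^bsub>\<sigma>(3)\<^esub>)\<close>.
\<close>

datatype op_symmetry = No_Symmetry | Symmetric | Antisymmetric

type_synonym 'k relation = "((nat \<Rightarrow> nat) \<Rightarrow> 'k) \<times> ((nat \<Rightarrow> nat) \<Rightarrow> 'k)"

datatype 'k operad = Operad (op_symmetry: op_symmetry) (op_relations: "'k relation set")

definition satisfies_symmetry :: "op_symmetry \<Rightarrow> 'a::ab_group_add set \<Rightarrow> ('a \<Rightarrow> 'a \<Rightarrow> 'a) \<Rightarrow> bool" where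
  "satisfies_symmetry e A m \<longleftrightarrow>
     (case e of
        No_Symmetry \<Rightarrow> True
      | Symmetric \<Rightarrow> \<forall>x\<in>A. \<forall>y\<in>A. m x y = m y x
      | Antisymmetric \<Rightarrow> \<forall>x\<in>A. \<forall>y\<in>A. m x y = - m y x)"

definition satisfies_relation ::
  "'k::field relation \<Rightarrow> ('k \<Rightarrow> 'a::ab_group_add \<Rightarrow> 'a) \<Rightarrow> 'a set \<Rightarrow> ('a \<Rightarrow> 'a \<Rightarrow> 'a) \<Rightarrow> bool" where
  "satisfies_relation cd s A m \<longleftrightarrow>
     (\<forall>x :: nat \<Rightarrow> 'a. (\<forall>i\<in>{1,2,3}. x i \<in> A) \<longrightarrow>
        (\<Sum>\<sigma> | \<sigma> permutes {1,2,3}.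
            s (fst cd \<sigma>) (m (m (x (\<sigma> 1)) (x (\<sigma> 2))) (x (\<sigma> 3))) +
            s (snd cd \<sigma>) (m (x (\<sigma> 1)) (m (x (\<sigma> 2)) (x (\<sigma> 3))))) = 0)"

definition p_algebra ::
  "'k::field operad \<Rightarrow> ('k \<Rightarrow> 'a::ab_group_add \<Rightarrow> 'a) \<Rightarrow> 'a set \<Rightarrow> ('a \<Rightarrow> 'a \<Rightarrow> 'a) \<Rightarrow> bool" where
  "p_algebra P s A m \<longleftrightarrow>
     fd_space s A \<and> bilinear_on s A s A s A m \<and> satisfies_symmetry (op_symmetry P) A m \<and>
     (\<forall>cd\<in>op_relations P. satisfies_relation cd s A m)"

definition semidirect_mult ::
  "('a::ab_group_add \<Rightarrow> 'a \<Rightarrow> 'a) \<Rightarrow> ('a \<Rightarrow> 'v::ab_group_add \<Rightarrow> 'v) \<Rightarrow> ('a \<Rightarrow> 'v \<Rightarrow> 'v) \<Rightarrow>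
    'a \<times> 'v \<Rightarrow> 'a \<times> 'v \<Rightarrow> 'a \<times> 'v" where
  "semidirect_mult m l r = (\<lambda>(x, u) (y, v). (m x y, l x v + r y u))"

definition representation_of ::
  "'k::field operad \<Rightarrow> ('k \<Rightarrow> 'a::ab_group_add \<Rightarrow> 'a) \<Rightarrow> ('a \<Rightarrow> 'a \<Rightarrow> 'a) \<Rightarrow>
    ('k \<Rightarrow> 'v::ab_group_add \<Rightarrow> 'v) \<Rightarrow> 'v set \<Rightarrow> ('a \<Rightarrow> 'v \<Rightarrow> 'v) \<times> ('a \<Rightarrow> 'v \<Rightarrow> 'v) \<Rightarrow> bool" where
  "representation_of P sA mA sV V lr \<longleftrightarrow>
     fd_space sV V \<and> linear_to_End sA sV V (fst lr) \<and> linear_to_End sA sV V (snd lr) \<and>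
     p_algebra P (module_prod.scale sA sV) (UNIV \<times> V) (semidirect_mult mA (fst lr) (snd lr))"

text \<open>The row vector \<open>(f, g)\<close> times the matrix \<open>M\<close>.\<close>

definition row_act ::
  "('k::field \<Rightarrow> 'v::ab_group_add \<Rightarrow> 'v) \<Rightarrow> ('a \<Rightarrow> 'v \<Rightarrow> 'v) \<Rightarrow> ('a \<Rightarrow> 'v \<Rightarrow> 'v) \<Rightarrow> 'k^2^2 \<Rightarrow>
    ('a \<Rightarrow> 'v \<Rightarrow> 'v) \<times> ('a \<Rightarrow> 'v \<Rightarrow> 'v)" where
  "row_act s f g M =
     ((\<lambda>x v. s (M$1$1) (f x v) + s (M$2$1) (g x v)),
      (\<lambda>x v. s (M$1$2) (f x v) + s (M$2$2) (g x v)))"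

definition left_mult :: "('a \<Rightarrow> 'a \<Rightarrow> 'a) \<Rightarrow> 'a \<Rightarrow> 'a \<Rightarrow> 'a" where
  "left_mult m x y = m x y"

definition right_mult :: "('a \<Rightarrow> 'a \<Rightarrow> 'a) \<Rightarrow> 'a \<Rightarrow> 'a \<Rightarrow> 'a" where
  "right_mult m x y = m y x"

definition pre_p_algebra ::
  "'k::field operad \<Rightarrow> 'k^2^2 \<Rightarrow> ('k \<Rightarrow> 'a::ab_group_add \<Rightarrow> 'a) \<Rightarrow>
    ('a \<Rightarrow> 'a \<Rightarrow> 'a) \<Rightarrow> ('a \<Rightarrow> 'a \<Rightarrow> 'a) \<Rightarrow> bool" where
  "pre_p_algebra P M s succ prec \<longleftrightarrow>
     fd_space s UNIV \<and>
     bilinear_on s UNIV s UNIV s UNIV succ \<and> bilinear_on s UNIV s UNIV s UNIV prec \<and>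
     p_algebra P s UNIV (\<lambda>x y. succ x y + prec x y) \<and>
     representation_of P s (\<lambda>x y. succ x y + prec x y) s UNIV
       (row_act s (left_mult succ) (right_mult prec) M)"

definition compatible_pre_p_algebra ::
  "'k::field operad \<Rightarrow> 'k^2^2 \<Rightarrow> ('k \<Rightarrow> 'a::ab_group_add \<Rightarrow> 'a) \<Rightarrow> ('a \<Rightarrow> 'a \<Rightarrow> 'a) \<Rightarrow>
    ('a \<Rightarrow> 'a \<Rightarrow> 'a) \<Rightarrow> ('a \<Rightarrow> 'a \<Rightarrow> 'a) \<Rightarrow> bool" where
  "compatible_pre_p_algebra P M s m succ prec \<longleftrightarrow>
     pre_p_algebra P M s succ prec \<and> (\<forall>x y. m x y = succ x y + prec x y)"

definition O_operator ::
  "'k::field operad \<Rightarrow> 'k^2^2 \<Rightarrow> ('k \<Rightarrow> 'a::ab_group_add \<Rightarrow> 'a) \<Rightarrow> ('a \<Rightarrow> 'a \<Rightarrow> 'a) \<Rightarrow>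
    ('k \<Rightarrow> 'v::ab_group_add \<Rightarrow> 'v) \<Rightarrow> 'v set \<Rightarrow> ('a \<Rightarrow> 'v \<Rightarrow> 'v) \<Rightarrow> ('a \<Rightarrow> 'v \<Rightarrow> 'v) \<Rightarrow>
    ('v \<Rightarrow> 'a) \<Rightarrow> bool" where
  "O_operator P M sA mA sV V \<alpha> \<beta> T \<longleftrightarrow>
     fd_space sV V \<and> linear_to_End sA sV V \<alpha> \<and> linear_to_End sA sV V \<beta> \<and>
     representation_of P sA mA sV V (row_act sV \<alpha> \<beta> M) \<and>
     linear_on sV V sA UNIV T \<and>
     (\<forall>u\<in>V. \<forall>v\<in>V. mA (T u) (T v) = T (\<alpha> (T u) v + \<beta> (T v) u))"

definition invertible_O_operator ::
  "'k::field operad \<Rightarrow> 'k^2^2 \<Rightarrow> ('k \<Rightarrow> 'a::ab_group_add \<Rightarrow> 'a) \<Rightarrow> ('a \<Rightarrow> 'a \<Rightarrow> 'a) \<Rightarrow>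
    ('k \<Rightarrow> 'v::ab_group_add \<Rightarrow> 'v) \<Rightarrow> 'v set \<Rightarrow> ('a \<Rightarrow> 'v \<Rightarrow> 'v) \<Rightarrow> ('a \<Rightarrow> 'v \<Rightarrow> 'v) \<Rightarrow>
    ('v \<Rightarrow> 'a) \<Rightarrow> bool" where
  "invertible_O_operator P M sA mA sV V \<alpha> \<beta> T \<longleftrightarrow>
     O_operator P M sA mA sV V \<alpha> \<beta> T \<and> bij_betw T V UNIV"

text \<open>
  HOL cannot quantify existentially over types.  The existence of some finite-dimensional vector
  space is therefore expressed as the existence of a finite-dimensional subspace of the sequence
  space \<open>K\<^sup>\<nat>\<close>, with pointwise operations.  By the last lemma below, every finite-dimensional
  vector space, over whatever type, has an isomorphic copy of this form.
\<close>

definition seq_scale :: "'k::field \<Rightarrow> (nat \<Rightarrow> 'k) \<Rightarrow> (nat \<Rightarrow> 'k)" where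
  "seq_scale c f = (\<lambda>n. c * f n)"

lemma vector_space_seq_scale: "vector_space (seq_scale :: 'k::field \<Rightarrow> _)"
  by unfold_locales (auto simp: seq_scale_def fun_eq_iff algebra_simps)

lemma fd_space_embeds_in_seq:
  fixes s :: "'k::field \<Rightarrow> 'v::ab_group_add \<Rightarrow> 'v"
  assumes "fd_space s V"
  shows "\<exists>f W. fd_space (seq_scale :: 'k \<Rightarrow> _) W \<and> linear_on s V seq_scale W f \<and> bij_betw f V W"
proof -
  interpret S: vector_space s using assms by (simp add: fd_space_def)
  interpret Q: vector_space "seq_scale :: 'k \<Rightarrow> _" by (rule vector_space_seq_scale)
  obtain B0 where B0: "finite B0" "S.span B0 = V" using assms by (auto simp: fd_space_def)
  obtain B where B: "B \<subseteq> B0" "S.independent B" "B0 \<subseteq> S.span B"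
    using S.maximal_independent_subset[of B0] by metis
  have finB: "finite B" using B(1) B0(1) by (rule finite_subset)
  have spanB: "S.span B = V"
    using B B0 by (metis S.span_mono S.span_span subset_antisym)
  obtain e :: "nat \<Rightarrow> 'v" where e: "bij_betw e {..<card B} B"
    using ex_bij_betw_nat_finite[OF finB] by (auto simp: atLeast0LessThan)
  define f where "f v = (\<lambda>n. if n < card B then S.representation B v (e n) else 0)" for v
  have lin: "f (x + y) = f x + f y" "f (s c x) = seq_scale c (f x)" if "x \<in> V" "y \<in> V" for x y c
    using that B(2) spanB
    by (auto simp: f_def fun_eq_iff seq_scale_def S.representation_add S.representation_scale)
  have inj: "inj_on f V"
  proof (rule inj_onI)
    fix x y assume xy: "x \<in> V" "y \<in> V" "f x = f y"
    have eq: "S.representation B x b = S.representation B y b" if "b \<in> B" for b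
    proof -
      have "b \<in> e ` {..<card B}" using bij_betw_imp_surj_on[OF e] that by simp
      then obtain n where "n < card B" "e n = b" by auto
      then show ?thesis using fun_cong[OF xy(3), of n] by (simp add: f_def)
    qed
    have "x = (\<Sum>b\<in>B. s (S.representation B x b) b)"
      using S.sum_representation_eq[OF B(2) _ finB order_refl] xy(1) spanB by simp
    also have "\<dots> = (\<Sum>b\<in>B. s (S.representation B y b) b)" using eq by simp
    also have "\<dots> = y"
      using S.sum_representation_eq[OF B(2) _ finB order_refl] xy(2) spanB by simp
    finally show "x = y" .
  qed
  have sum_in: "(\<Sum>b\<in>C. s (r b) b) \<in> V" if "C \<subseteq> B" for C r
    unfolding spanB[symmetric] using that
    by (intro S.span_sum S.span_scale S.span_base) auto
  have f0: "f 0 = 0" by (simp add: f_def fun_eq_iff S.representation_zero)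
  have fsum: "f (\<Sum>b\<in>C. s (r b) b) = (\<Sum>b\<in>C. seq_scale (r b) (f b))" if "C \<subseteq> B" for C r
    using finite_subset[OF that finB] that
  proof (induction C rule: finite_induct)
    case empty
    then show ?case by (simp add: f0)
  next
    case (insert b C)
    have "b \<in> V" "s (r b) b \<in> V" using insert.prems spanB S.span_base S.span_scale by auto
    then show ?case using insert lin sum_in[of C r] by auto
  qed
  have im: "f ` V = Q.span (f ` B)"
  proof
    show "f ` V \<subseteq> Q.span (f ` B)"
    proof
      fix w assume "w \<in> f ` V"
      then obtain v where v: "v \<in> V" "w = f v" by auto
      have "v = (\<Sum>b\<in>B. s (S.representation B v b) b)"
        using S.sum_representation_eq[OF B(2) _ finB order_refl] v(1) spanB by simp
      then have "w = (\<Sum>b\<in>B. seq_scale (S.representation B v b) (f b))"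
        using fsum[of B "S.representation B v"] v(2) by simp
      then show "w \<in> Q.span (f ` B)" 
        by (auto intro: Q.span_sum Q.span_scale Q.span_base)
    qed
    show "Q.span (f ` B) \<subseteq> f ` V"
    proof (rule Q.span_minimal)
      show "f ` B \<subseteq> f ` V" using spanB S.span_base by auto
      show "Q.subspace (f ` V)"
      proof (rule Q.subspaceI)
        show "0 \<in> f ` V" using f0 spanB S.span_zero by force
        show "x + y \<in> f ` V" if "x \<in> f ` V" "y \<in> f ` V" for x y
        proof -
          obtain a b where ab: "a \<in> V" "b \<in> V" "x = f a" "y = f b" using \<open>x \<in> f ` V\<close> \<open>y \<in> f ` V\<close> by auto
          then have "a + b \<in> V" using S.span_add[of a B b] spanB by simp
          then show ?thesis using ab lin(1)[of a b] by (metis imageI)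
        qed
        show "seq_scale c x \<in> f ` V" if "x \<in> f ` V" for c x
        proof -
          obtain a where a: "a \<in> V" "x = f a" using \<open>x \<in> f ` V\<close> by auto
          then have "s c a \<in> V" using S.span_scale[of a B c] spanB by simp
          then show ?thesis using a lin(2)[of a a c] by (metis imageI)
        qed
      qed
    qed
  qed
  have "fd_space (seq_scale :: 'k \<Rightarrow> _) (f ` V)"
    unfolding fd_space_def im using finB Q.vector_space_axioms Q.subspace_span by blast
  moreover have "linear_on s V seq_scale (f ` V) f"
    using lin by (auto simp: linear_on_def)
  ultimately show ?thesis using inj by (auto simp: bij_betw_def)
qed

end

theory Submission
  imports Defs
begin

text \<open>
  Identities pass to homomorphic images, so a representation on \<open>V\<close> is carried by a surjective
  linear map \<open>V \<rightarrow> W\<close> to any pair of actions on \<open>W\<close> that it intertwines.  An invertible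
  \<open>\<O>\<close>-operator \<open>T\<close> intertwines \<open>(\<alpha>, \<beta>)\<close> with \<open>(L\<^sub>\<succ>, R\<^sub>\<prec>)\<close>, and the \<open>\<O>\<close>-operator equation then
  reads \<open>x \<circ> y = x \<succ> y + x \<prec> y\<close>.  Conversely, the identity of \<open>A\<close> is an \<open>\<O>\<close>-operator associated
  to \<open>(L\<^sub>\<succ>, R\<^sub>\<prec>, A)\<close>, and it is transported to an isomorphic copy of \<open>A\<close> inside \<open>K\<^sup>\<nat>\<close>.
\<close>

section \<open>Linear maps between carriers: zero, negatives and finite sums\<close>

lemma linear_onD:
  assumes "linear_on s V t W f" "x \<in> V"
  shows "f x \<in> W" "y \<in> V \<Longrightarrow> f (x + y) = f x + f y" "f (s c x) = t c (f x)"
  using assms by (auto simp: linear_on_def)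

lemma bilinear_onD:
  assumes "bilinear_on r U s V t W m" "x \<in> U" "y \<in> V"
  shows "m x y \<in> W"
    and "y' \<in> V \<Longrightarrow> m x (y + y') = m x y + m x y'" "m x (s c y) = t c (m x y)"
    and "x' \<in> U \<Longrightarrow> m (x + x') y = m x y + m x' y" "m (r c x) y = t c (m x y)"
  using assms by (auto simp: bilinear_on_def linear_on_def)

lemma fd_spaceD:
  assumes "fd_space s V"
  shows "vector_space s" "0 \<in> V" "x \<in> V \<Longrightarrow> y \<in> V \<Longrightarrow> x + y \<in> V" "x \<in> V \<Longrightarrow> s c x \<in> V"
proof -
  show "vector_space s" using assms by (simp add: fd_space_def)
  then interpret vector_space s .
  have V: "subspace V" using assms by (simp add: fd_space_def)
  show "0 \<in> V" "x \<in> V \<Longrightarrow> y \<in> V \<Longrightarrow> x + y \<in> V" "x \<in> V \<Longrightarrow> s c x \<in> V"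
    using V by (auto intro: subspace_0 subspace_add subspace_scale)
qed

lemma linear_on_zero:
  assumes "fd_space s V" "linear_on s V t W f"
  shows "f 0 = 0"
  using linear_onD(2)[OF assms(2) fd_spaceD(2)[OF assms(1)] fd_spaceD(2)[OF assms(1)]] by simp

lemma linear_on_uminus:
  assumes "fd_space s V" "vector_space t" "linear_on s V t W f" "x \<in> V"
  shows "- x \<in> V" "f (- x) = - f x"
proof -
  interpret S: vector_space s using assms(1) by (rule fd_spaceD)
  interpret T: vector_space t by fact
  \<comment> \<open>Negation is scaling by -1, so closure and compatibility with it come from the
    scaling axioms.\<close>
  show "- x \<in> V" using fd_spaceD(4)[OF assms(1) assms(4), of "-1"] by simp
  show "f (- x) = - f x" using linear_onD(3)[OF assms(3) assms(4), of "-1"] by simp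
qed

text \<open>Membership and additivity are proved in one induction: splitting off a summand under
  \<open>f\<close> requires the remaining partial sum to lie in \<open>V\<close>.\<close>

lemma linear_on_sum:
  assumes "fd_space s V" "linear_on s V t W f" "finite I" "\<And>i. i \<in> I \<Longrightarrow> g i \<in> V"
  shows "sum g I \<in> V \<and> f (sum g I) = (\<Sum>i\<in>I. f (g i))"
  using assms(3,4)
proof (induction I rule: finite_induct)
  case empty
  then show ?case using linear_on_zero[OF assms(1,2)] fd_spaceD(2)[OF assms(1)] by simp
next
  case (insert i I)
  then show ?case
    by (simp add: fd_spaceD(3)[OF assms(1)] linear_onD(2)[OF assms(2)])
qed

section \<open>Transport of spaces and bilinear maps along linear maps\<close>

lemma linear_on_inv_into:
  assumes "fd_space s V" "linear_on s V t W f" "bij_betw f V W"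
  shows "linear_on t W s V (inv_into V f)"
proof -
  have W: "W = f ` V" and inj: "inj_on f V" using assms(3) by (auto simp: bij_betw_def)
  \<comment> \<open>It suffices to argue on elements of the form \<open>f x\<close>, since these
    exhaust \<open>W\<close>.\<close>
  have "inv_into V f (f x + f y) = x + y" if "x \<in> V" "y \<in> V" for x y
    using that linear_onD(2)[OF assms(2) that] fd_spaceD(3)[OF assms(1) that] inj
    by (metis inv_into_f_f)
  moreover have "inv_into V f (t c (f x)) = s c x" if "x \<in> V" for x c
    using linear_onD(3)[OF assms(2) that] fd_spaceD(4)[OF assms(1) that] inj
    by (metis inv_into_f_f)
  ultimately show ?thesis
    unfolding linear_on_def W using inj by simp
qed

text \<open>The image of a finite spanning set of \<open>V\<close> spans the image of
  \<open>V\<close>.\<close>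

lemma fd_space_image:
  assumes V: "fd_space s V" and t: "vector_space t"
    and f: "linear_on s V t W f" and W: "f ` V = W"
  shows "fd_space t W"
proof -
  interpret S: vector_space s using V by (rule fd_spaceD)
  interpret T: vector_space t by fact
  obtain B where B: "finite B" "S.span B = V" using V by (auto simp: fd_space_def)
  have WS: "T.subspace W"
  proof (rule T.subspaceI)
    show "0 \<in> W" using linear_on_zero[OF V f] fd_spaceD(2)[OF V] W by force
    show "x + y \<in> W" if "x \<in> W" "y \<in> W" for x y
    proof -
      obtain a b where "a \<in> V" "b \<in> V" "x = f a" "y = f b"
        using \<open>x \<in> W\<close> \<open>y \<in> W\<close> unfolding W[symmetric] by blast
      then show ?thesis
        using linear_onD(2)[OF f, of a b] fd_spaceD(3)[OF V, of a b] W by (metis imageI)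
    qed
    show "t c x \<in> W" if "x \<in> W" for c x
    proof -
      obtain a where "a \<in> V" "x = f a"
        using \<open>x \<in> W\<close> unfolding W[symmetric] by blast
      then show ?thesis
        using linear_onD(3)[OF f, of a c] fd_spaceD(4)[OF V, of a c] W by (metis imageI)
    qed
  qed
  have "V \<subseteq> {x \<in> V. f x \<in> T.span (f ` B)}"
  proof -
    have "S.subspace {x \<in> V. f x \<in> T.span (f ` B)}"
      using fd_spaceD[OF V] linear_on_zero[OF V f] linear_onD[OF f]
      by (intro S.subspaceI) (auto intro: T.span_zero T.span_add T.span_scale)
    moreover have "B \<subseteq> {x \<in> V. f x \<in> T.span (f ` B)}"
      using B(2) S.span_base by (auto intro: T.span_base)
    ultimately show ?thesis using S.span_minimal B(2) by metis
  qed
  then have "W \<subseteq> T.span (f ` B)" using W by auto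
  moreover have "f ` B \<subseteq> W" using B(2) W S.span_superset by blast
  then have "T.span (f ` B) \<subseteq> W" using WS by (rule T.span_minimal)
  ultimately have "T.span (f ` B) = W" by blast
  then show ?thesis using B(1) WS t by (auto simp: fd_space_def)
qed

text \<open>Arguments of \<open>m'\<close> lift along the surjections \<open>f\<close> and
  \<open>g\<close>; there bilinearity of \<open>m\<close> applies, and \<open>h\<close> carries the
  result back. Keeping three separate maps covers both multiplications (\<open>f\<close>,
  \<open>g\<close> and \<open>h\<close> equal) and actions of a fixed algebra (\<open>f\<close> the
  identity).\<close>

lemma bilinear_on_image:
  assumes m: "bilinear_on r U s V t W m" and U: "fd_space r U" and V: "fd_space s V"
    and f: "linear_on r U r' U' f" "f ` U = U'"
    and g: "linear_on s V s' V' g" "g ` V = V'"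
    and h: "linear_on t W t' W' h"
    and m': "\<And>x y. x \<in> U \<Longrightarrow> y \<in> V \<Longrightarrow> m' (f x) (g y) = h (m x y)"
  shows "bilinear_on r' U' s' V' t' W' m'"
proof -
  note mD = bilinear_onD[OF m]
  have "m' (f x) (g y + g y') = m' (f x) (g y) + m' (f x) (g y')"
    if "x \<in> U" "y \<in> V" "y' \<in> V" for x y y'
    using that m'[of x "y + y'"] fd_spaceD(3)[OF V, of y y']
    by (simp add: m' mD linear_onD[OF g(1)] linear_onD[OF h])
  moreover have "m' (f x) (s' c (g y)) = t' c (m' (f x) (g y))" if "x \<in> U" "y \<in> V" for x y c
    using that m'[of x "s c y"] fd_spaceD(4)[OF V, of y c]
    by (simp add: m' mD linear_onD[OF g(1)] linear_onD[OF h])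
  moreover have "m' (f x + f x') (g y) = m' (f x) (g y) + m' (f x') (g y)"
    if "x \<in> U" "x' \<in> U" "y \<in> V" for x x' y
    using that m'[of "x + x'" y] fd_spaceD(3)[OF U, of x x']
    by (simp add: m' mD linear_onD[OF f(1)] linear_onD[OF h])
  moreover have "m' (r' c (f x)) (g y) = t' c (m' (f x) (g y))" if "x \<in> U" "y \<in> V" for x y c
    using that m'[of "r c x" y] fd_spaceD(4)[OF U, of x c]
    by (simp add: m' mD linear_onD[OF f(1)] linear_onD[OF h])
  moreover have "m' (f x) (g y) \<in> W'" if "x \<in> U" "y \<in> V" for x y
    using that by (simp add: m' mD linear_onD[OF h])
  ultimately show ?thesis
    unfolding bilinear_on_def linear_on_def f(2)[symmetric] g(2)[symmetric] by simp
qed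

section \<open>Quadratic identities and \<open>P\<close>-algebras under surjective
  homomorphisms\<close>

lemma satisfies_relation_image:
  assumes rel: "satisfies_relation cd s A m"
    and A: "fd_space s A" and m: "bilinear_on s A s A s A m"
    and g: "linear_on s A t B g" "g ` A = B"
    and m': "\<And>x y. x \<in> A \<Longrightarrow> y \<in> A \<Longrightarrow> m' (g x) (g y) = g (m x y)"
  shows "satisfies_relation cd t B m'"
  unfolding satisfies_relation_def
proof (intro allI impI)
  fix x :: "nat \<Rightarrow> 'c"
  assume x: "\<forall>i\<in>{1,2,3}. x i \<in> B"
  \<comment> \<open>The \<open>y i\<close> are preimages of the \<open>x i\<close>; the relation is
    evaluated at \<open>y\<close> in \<open>A\<close> and then pushed forward by
    \<open>g\<close>.\<close>
  define y where "y i = inv_into A g (x i)" for i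
  have y: "y i \<in> A" "g (y i) = x i" if "i \<in> {1,2,3}" for i
    using that x g(2) by (auto simp: y_def inv_into_into f_inv_into_f)
  let ?S = "{\<sigma>. \<sigma> permutes {1,2,3::nat}}"
  let ?m = "\<lambda>\<sigma>. s (fst cd \<sigma>) (m (m (y (\<sigma> 1)) (y (\<sigma> 2))) (y (\<sigma> 3))) +
     s (snd cd \<sigma>) (m (y (\<sigma> 1)) (m (y (\<sigma> 2)) (y (\<sigma> 3))))"
  \<comment> \<open>Only the values of \<open>y\<close> at 1, 2, 3 are controlled, so the permuted
    indices must be seen to stay among these three.\<close>
  have \<sigma>: "\<sigma> 1 \<in> {1,2,3}" "\<sigma> 2 \<in> {1,2,3}" "\<sigma> 3 \<in> {1,2,3}" if "\<sigma> \<in> ?S" for \<sigma>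
    using that permutes_in_image[of \<sigma> "{1,2,3}"] by blast+
  note closed = bilinear_onD(1)[OF m] fd_spaceD(3,4)[OF A]
  have mem: "?m \<sigma> \<in> A" if "\<sigma> \<in> ?S" for \<sigma>
    using y(1)[OF \<sigma>(1)[OF that]] y(1)[OF \<sigma>(2)[OF that]] y(1)[OF \<sigma>(3)[OF that]]
    by (intro closed)
  have eq: "g (?m \<sigma>) = t (fst cd \<sigma>) (m' (m' (x (\<sigma> 1)) (x (\<sigma> 2))) (x (\<sigma> 3))) +
     t (snd cd \<sigma>) (m' (x (\<sigma> 1)) (m' (x (\<sigma> 2)) (x (\<sigma> 3))))" if "\<sigma> \<in> ?S" for \<sigma>
    using y(1)[OF \<sigma>(1)[OF that]] y(1)[OF \<sigma>(2)[OF that]] y(1)[OF \<sigma>(3)[OF that]]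
    \<comment> \<open>Each \<open>x (\<sigma> i)\<close> is replaced by
      \<open>g (y (\<sigma> i))\<close>, after which \<open>g\<close> moves outwards. The numeral 1
      is kept from turning into \<open>Suc 0\<close>, so that the facts about
      \<open>\<sigma> 1\<close> still match.\<close>
    by (simp add: y(2)[OF \<sigma>(1)[OF that], symmetric] y(2)[OF \<sigma>(2)[OF that], symmetric]
      y(2)[OF \<sigma>(3)[OF that], symmetric] m' linear_onD[OF g(1)] closed del: One_nat_def)
  have "sum ?m ?S = 0"
    using rel[unfolded satisfies_relation_def] y(1) by blast
  moreover have "g (sum ?m ?S) = (\<Sum>\<sigma>\<in>?S. g (?m \<sigma>))"
    using linear_on_sum[OF A g(1) finite_permutations[of "{1,2,3::nat}"], of ?m] mem by blast
  ultimately show "(\<Sum>\<sigma>\<in>?S. t (fst cd \<sigma>) (m' (m' (x (\<sigma> 1)) (x (\<sigma> 2))) (x (\<sigma> 3))) +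
     t (snd cd \<sigma>) (m' (x (\<sigma> 1)) (m' (x (\<sigma> 2)) (x (\<sigma> 3))))) = 0"
    using linear_on_zero[OF A g(1)] eq by simp
qed

lemma p_algebra_image:
  assumes P: "p_algebra P s A m" and t: "vector_space t"
    and g: "linear_on s A t B g" "g ` A = B"
    and m': "\<And>x y. x \<in> A \<Longrightarrow> y \<in> A \<Longrightarrow> m' (g x) (g y) = g (m x y)"
  shows "p_algebra P t B m'"
proof -
  have A: "fd_space s A" and m: "bilinear_on s A s A s A m"
    and sym: "satisfies_symmetry (op_symmetry P) A m"
    and rel: "\<And>cd. cd \<in> op_relations P \<Longrightarrow> satisfies_relation cd s A m"
    using P by (auto simp: p_algebra_def)
  have "satisfies_symmetry (op_symmetry P) B m'"
  proof (cases "op_symmetry P")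
    case No_Symmetry
    then show ?thesis by (simp add: satisfies_symmetry_def)
  next
    case Symmetric
    then have comm: "m x y = m y x" if "x \<in> A" "y \<in> A" for x y
      using sym that unfolding satisfies_symmetry_def by simp
    have "m' (g x) (g y) = m' (g y) (g x)" if "x \<in> A" "y \<in> A" for x y
      unfolding m'[OF that] m'[OF that(2,1)] comm[OF that] ..
    then show ?thesis
      unfolding satisfies_symmetry_def Symmetric op_symmetry.case g(2)[symmetric] by blast
  next
    case Antisymmetric
    have anti: "m x y = - m y x" if "x \<in> A" "y \<in> A" for x y
      using sym that unfolding satisfies_symmetry_def Antisymmetric op_symmetry.case by blast
    have "m' (g x) (g y) = - m' (g y) (g x)" if "x \<in> A" "y \<in> A" for x y
      using linear_on_uminus(2)[OF A t g(1) bilinear_onD(1)[OF m that(2,1)]]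
      unfolding m'[OF that] m'[OF that(2,1)] anti[OF that] .
    then show ?thesis
      unfolding satisfies_symmetry_def Antisymmetric op_symmetry.case g(2)[symmetric] by blast
  qed
  moreover have "fd_space t B" by (rule fd_space_image[OF A t g])
  moreover have "bilinear_on t B t B t B m'" by (rule bilinear_on_image[OF m A A g g g(1)]) (rule m')
  moreover have "satisfies_relation cd t B m'" if "cd \<in> op_relations P" for cd
    by (rule satisfies_relation_image[OF rel[OF that] A m g]) (rule m')
  ultimately show ?thesis by (simp add: p_algebra_def)
qed

section \<open>Transport of representations\<close>

lemma vector_space_prod_scale:
  assumes "vector_space s" "vector_space t"
  shows "vector_space (module_prod.scale s t)"
    and "module_prod.scale s t c (x, y) = (s c x, t c y)"
proof -
  \<comment> \<open>Inside this locale the scaling on the product unfolds componentwise; both facts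
    are exported for use with explicit scalings.\<close>
  interpret vector_space_prod s t using assms by (intro vector_space_prod.intro vector_space_pair.intro)
  show "vector_space (module_prod.scale s t)" by unfold_locales
  show "module_prod.scale s t c (x, y) = (s c x, t c y)" by (simp add: scale_def)
qed

text \<open>A representation amounts to a \<open>P\<close>-algebra structure on the sum of
  \<open>A\<close> and \<open>V\<close>. The identity of \<open>A\<close> paired with
  \<open>f\<close> maps this sum onto that of \<open>A\<close> and \<open>W\<close>, and it is
  multiplicative precisely because \<open>f\<close> intertwines the actions.\<close>

lemma representation_of_image:
  fixes mA :: "'a::ab_group_add \<Rightarrow> 'a \<Rightarrow> 'a"
  assumes rep: "representation_of P sA mA s V lr"
    and A: "fd_space sA UNIV" and t: "vector_space t"
    and f: "linear_on s V t W f" "f ` V = W"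
    and l': "\<And>x v. v \<in> V \<Longrightarrow> fst lr' x (f v) = f (fst lr x v)"
    and r': "\<And>x v. v \<in> V \<Longrightarrow> snd lr' x (f v) = f (snd lr x v)"
  shows "representation_of P sA mA t W lr'"
proof -
  have V: "fd_space s V" and l: "linear_to_End sA s V (fst lr)" and r: "linear_to_End sA s V (snd lr)"
    and alg: "p_algebra P (module_prod.scale sA s) (UNIV \<times> V) (semidirect_mult mA (fst lr) (snd lr))"
    using rep by (auto simp: representation_of_def)
  have id: "linear_on sA UNIV sA UNIV (\<lambda>x. x)" by (simp add: linear_on_def)
  note ps = vector_space_prod_scale[OF fd_spaceD(1)[OF A]]
  let ?g = "map_prod (\<lambda>x::'a. x) f"
  have g: "linear_on (module_prod.scale sA s) (UNIV \<times> V) (module_prod.scale sA t) (UNIV \<times> W) ?g"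
    using linear_onD[OF f(1)]
    by (auto simp: linear_on_def ps(2)[OF t] ps(2)[OF fd_spaceD(1)[OF V]])
  have img: "?g ` (UNIV \<times> V) = UNIV \<times> W" using f(2) by (simp add: map_prod_surj_on)
  have hom: "semidirect_mult mA (fst lr') (snd lr') (?g p) (?g q) =
      ?g (semidirect_mult mA (fst lr) (snd lr) p q)"
    if "p \<in> UNIV \<times> V" "q \<in> UNIV \<times> V" for p q
    using that bilinear_onD(1)[OF l] bilinear_onD(1)[OF r]
    by (auto simp: semidirect_mult_def l' r' linear_onD(2)[OF f(1)])
  have "fd_space t W" by (rule fd_space_image[OF V t f])
  moreover have "linear_to_End sA t W (fst lr')"
    by (rule bilinear_on_image[OF l A V id _ f f(1)]) (simp_all add: l')
  moreover have "linear_to_End sA t W (snd lr')"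
    by (rule bilinear_on_image[OF r A V id _ f f(1)]) (simp_all add: r')
  moreover have "p_algebra P (module_prod.scale sA t) (UNIV \<times> W)
      (semidirect_mult mA (fst lr') (snd lr'))"
    by (rule p_algebra_image[OF alg ps(1)[OF t] g img]) (rule hom)
  ultimately show ?thesis by (simp add: representation_of_def)
qed

text \<open>Both components of the row vector times \<open>M\<close> are fixed linear combinations
  of the two actions, so a linear map intertwining the actions also intertwines these combinations,
  for every matrix \<open>M\<close>.\<close>

lemma row_act_image:
  assumes V: "fd_space s V" and f: "linear_on s V t W f"
    and \<alpha>: "linear_to_End sA s V \<alpha>" and \<beta>: "linear_to_End sA s V \<beta>"
    and \<alpha>': "\<And>x v. v \<in> V \<Longrightarrow> \<alpha>' x (f v) = f (\<alpha> x v)"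
    and \<beta>': "\<And>x v. v \<in> V \<Longrightarrow> \<beta>' x (f v) = f (\<beta> x v)"
    and v: "v \<in> V"
  shows "fst (row_act t \<alpha>' \<beta>' M) x (f v) = f (fst (row_act s \<alpha> \<beta> M) x v)"
    and "snd (row_act t \<alpha>' \<beta>' M) x (f v) = f (snd (row_act s \<alpha> \<beta> M) x v)"
  using v bilinear_onD(1)[OF \<alpha> _ v] bilinear_onD(1)[OF \<beta> _ v]
  by (simp_all add: row_act_def \<alpha>' \<beta>' linear_onD[OF f] fd_spaceD(4)[OF V])

section \<open>Multiplication operators and the two directions of the equivalence\<close>

lemma left_mult_eq: "left_mult m = m"
  by (simp add: left_mult_def fun_eq_iff)

text \<open>Exchanging the arguments merely swaps the two linearity conditions, as both arguments
  range over the same space.\<close>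

lemma bilinear_on_right_mult_iff:
  "bilinear_on s V s V s V (right_mult m) \<longleftrightarrow> bilinear_on s V s V s V m"
proof -
  have "right_mult m x = (\<lambda>y. m y x)" for x by (simp add: right_mult_def fun_eq_iff)
  then show ?thesis by (auto simp: bilinear_on_def)
qed

lemma invertible_O_operator_imp_compatible:
  assumes P: "p_algebra P sA UNIV mA"
    and T: "invertible_O_operator P M sA mA sV V \<alpha> \<beta> T"
  shows "compatible_pre_p_algebra P M sA mA
    (\<lambda>x y. T (\<alpha> x (inv_into V T y))) (\<lambda>x y. T (\<beta> y (inv_into V T x)))"
    (is "compatible_pre_p_algebra P M sA mA ?succ ?prec")
proof -
  have V: "fd_space sV V" and \<alpha>: "linear_to_End sA sV V \<alpha>" and \<beta>: "linear_to_End sA sV V \<beta>"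
    and rep: "representation_of P sA mA sV V (row_act sV \<alpha> \<beta> M)"
    and lin: "linear_on sV V sA UNIV T"
    and O: "\<And>u v. u \<in> V \<Longrightarrow> v \<in> V \<Longrightarrow> mA (T u) (T v) = T (\<alpha> (T u) v + \<beta> (T v) u)"
    and img: "T ` V = UNIV" and inj: "inj_on T V"
    using T by (auto simp: invertible_O_operator_def O_operator_def bij_betw_def)
  have A: "fd_space sA UNIV" using P by (simp add: p_algebra_def)
  have id: "linear_on sA UNIV sA UNIV (\<lambda>x. x)" by (simp add: linear_on_def)
  have inv: "inv_into V T x \<in> V" "T (inv_into V T x) = x" for x
    using img by (auto intro: inv_into_into f_inv_into_f)
  \<comment> \<open>This is the \<open>\<O>\<close>-operator equation at the preimages of
    \<open>x\<close> and \<open>y\<close> under \<open>T\<close>.\<close>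
  have sum: "mA x y = ?succ x y + ?prec x y" for x y
    using O[OF inv(1) inv(1), of x y] inv bilinear_onD(1)[OF \<alpha> _ inv(1)]
      bilinear_onD(1)[OF \<beta> _ inv(1)] by (simp add: linear_onD(2)[OF lin])
  \<comment> \<open>The intertwining relations of \<open>T\<close>, in the form that the transport
    lemmas expect. \<open>\<beta>\<close> corresponds to right multiplication, which is why
    \<open>?prec\<close> appears with its arguments exchanged.\<close>
  have succ: "?succ x (T v) = T (\<alpha> x v)" and prec: "right_mult ?prec x (T v) = T (\<beta> x v)"
    if "v \<in> V" for x v
    using that inj by (simp_all add: right_mult_def)
  \<comment> \<open>The algebra argument is carried by the identity, while the module argument and
    the value are carried by \<open>T\<close>.\<close>
  have "bilinear_on sA UNIV sA UNIV sA UNIV ?succ"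
    by (rule bilinear_on_image[OF \<alpha> A V id _ lin img lin]) (simp_all add: succ)
  moreover have "bilinear_on sA UNIV sA UNIV sA UNIV (right_mult ?prec)"
    by (rule bilinear_on_image[OF \<beta> A V id _ lin img lin]) (simp_all add: prec)
  then have "bilinear_on sA UNIV sA UNIV sA UNIV ?prec"
    by (simp only: bilinear_on_right_mult_iff)
  moreover have "representation_of P sA mA sA UNIV (row_act sA (left_mult ?succ) (right_mult ?prec) M)"
    by (rule representation_of_image[OF rep A fd_spaceD(1)[OF A] lin img];
        rule row_act_image[OF V lin \<alpha> \<beta>]) (simp_all add: left_mult_eq succ prec)
  moreover have "mA = (\<lambda>x y. ?succ x y + ?prec x y)" using sum by (intro ext)
  ultimately show ?thesis
    unfolding compatible_pre_p_algebra_def pre_p_algebra_def using A P sum by metis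
qed

text \<open>Conjugating left and right multiplication by an isomorphism \<open>f\<close> from
  \<open>A\<close> onto \<open>W\<close> gives actions on \<open>W\<close>, for which the inverse of
  \<open>f\<close> plays the part that the identity plays on \<open>A\<close>. The space
  \<open>W\<close> stays arbitrary here.\<close>

lemma compatible_imp_invertible_O_operator:
  fixes sV :: "'k::field \<Rightarrow> 'v::ab_group_add \<Rightarrow> 'v"
  assumes c: "compatible_pre_p_algebra P M sA mA succ prec"
    and W: "fd_space sV W" and f: "linear_on sA UNIV sV W f" "bij_betw f UNIV W"
  shows "invertible_O_operator P M sA mA sV W
    (\<lambda>x w. f (succ x (inv f w))) (\<lambda>x w. f (prec (inv f w) x)) (inv f)"
    (is "invertible_O_operator P M sA mA sV W ?\<alpha> ?\<beta> _")
proof -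
  have sum: "mA = (\<lambda>x y. succ x y + prec x y)"
    using c by (simp add: compatible_pre_p_algebra_def fun_eq_iff)
  have A: "fd_space sA UNIV" and succ: "bilinear_on sA UNIV sA UNIV sA UNIV succ"
    and prec: "bilinear_on sA UNIV sA UNIV sA UNIV prec"
    and rep: "representation_of P sA mA sA UNIV (row_act sA (left_mult succ) (right_mult prec) M)"
    using c by (auto simp: compatible_pre_p_algebra_def pre_p_algebra_def sum)
  have l: "linear_to_End sA sA UNIV (left_mult succ)"
    using succ by (simp only: left_mult_eq)
  have r: "linear_to_End sA sA UNIV (right_mult prec)"
    using prec by (simp only: bilinear_on_right_mult_iff)
  have id: "linear_on sA UNIV sA UNIV (\<lambda>x. x)" by (simp add: linear_on_def)
  have img: "f ` UNIV = W" and inj: "inj f" using f(2) by (auto simp: bij_betw_def)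
  have \<alpha>: "?\<alpha> x (f v) = f (left_mult succ x v)" and \<beta>: "?\<beta> x (f v) = f (right_mult prec x v)" for x v
    using inj by (simp_all add: left_mult_eq right_mult_def)
  have "linear_to_End sA sV W ?\<alpha>"
    by (rule bilinear_on_image[OF l A A id _ f(1) img f(1)]) (simp_all add: \<alpha>)
  moreover have "linear_to_End sA sV W ?\<beta>"
    by (rule bilinear_on_image[OF r A A id _ f(1) img f(1)]) (simp_all add: \<beta>)
  moreover have "representation_of P sA mA sV W (row_act sV ?\<alpha> ?\<beta> M)"
    by (rule representation_of_image[OF rep A fd_spaceD(1)[OF W] f(1) img];
        rule row_act_image[OF A f(1) l r]) (rule \<alpha> \<beta> UNIV_I)+
  \<comment> \<open>The two summands on the right are values of \<open>f\<close>; by additivity they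
    merge into \<open>f\<close> of the product in \<open>A\<close>, and \<open>inv f\<close>
    cancels.\<close>
  moreover have "mA (inv f u) (inv f v) = inv f (?\<alpha> (inv f u) v + ?\<beta> (inv f v) u)" for u v
    using inj by (simp add: sum flip: linear_onD(2)[OF f(1) UNIV_I UNIV_I])
  ultimately show ?thesis
    unfolding invertible_O_operator_def O_operator_def
    using W linear_on_inv_into[OF A f] bij_betw_inv_into[OF f(2)] by blast
qed

theorem theorem2p10:
  fixes P :: "'k::{alg_closed_field, field_char_0} operad"
    and M :: "'k^2^2"
    and sA :: "'k \<Rightarrow> 'a::ab_group_add \<Rightarrow> 'a"
    and mA :: "'a \<Rightarrow> 'a \<Rightarrow> 'a"
  assumes "p_algebra P sA UNIV mA"
  shows "((\<exists>succ prec. compatible_pre_p_algebra P M sA mA succ prec) \<longleftrightarrow>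
          (\<exists>(V :: (nat \<Rightarrow> 'k) set) \<alpha> \<beta> T. invertible_O_operator P M sA mA seq_scale V \<alpha> \<beta> T)) \<and>
         (\<forall>(sV :: 'k \<Rightarrow> 'v::ab_group_add \<Rightarrow> 'v) V \<alpha> \<beta> T.
            invertible_O_operator P M sA mA sV V \<alpha> \<beta> T \<longrightarrow>
            compatible_pre_p_algebra P M sA mA
              (\<lambda>x y. T (\<alpha> x (inv_into V T y)))
              (\<lambda>x y. T (\<beta> y (inv_into V T x))))"
proof (intro conjI allI impI iffI)
  assume "\<exists>succ prec. compatible_pre_p_algebra P M sA mA succ prec"
  then obtain succ prec where "compatible_pre_p_algebra P M sA mA succ prec" by blast
  moreover obtain f and W :: "(nat \<Rightarrow> 'k) set"
    where "fd_space seq_scale W" "linear_on sA UNIV seq_scale W f" "bij_betw f UNIV W"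
    using fd_space_embeds_in_seq[of sA UNIV] assms by (auto simp: p_algebra_def)
  ultimately show "\<exists>(V :: (nat \<Rightarrow> 'k) set) \<alpha> \<beta> T. invertible_O_operator P M sA mA seq_scale V \<alpha> \<beta> T"
    using compatible_imp_invertible_O_operator by blast
\<comment> \<open>The explicit formulas settle both remaining goals: the converse implication, with
  \<open>V\<close> a space of sequences, and the final claim, with \<open>V\<close> over an
  arbitrary type.\<close>
qed (use assms invertible_O_operator_imp_compatible in blast)+

end
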